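(* Let $$f(\mathbf{x})=\mathbf{x}^{\mathsf T}\mathsf{A}\mathbf{x}+2\mathbf{a}^{\mathsf T}\mathbf{x}+\max_{\mathbf{u}\in\mathbb{R}^q}\{2\mathbf{u}^{\mathsf T}\mathsf{B}\mathbf{x}+\mathbf{u}^{\mathsf T}\mathsf{C}\mathbf{u}+2\mathbf{c}^{\mathsf T}\mathbf{u}:\mathbf{u}\in\mathcal{U}\},\qquad\mathbf{x}\in\mathbb{R}^n,$$ where $\mathcal{U}\subseteq\mathbb{R}^q$ is nonempty, compact and convex, $\mathsf{A}\in\mathcal{S}^n$, $\mathsf{B}\in\mathbb{R}^{q\times n}$, $\mathsf{C}\in\mathcal{S}^q$, $\mathbf{a}\in\mathbb{R}^n$, $\mathbf{c}\in\mathbb{R}^q$. Let $\mathcal{X}\subseteq\mathbb{R}^n$ be closed, and let $\mathcal{A}:\mathcal{S}^n\times\mathbb{R}^n\to\mathbb{R}^m$ be a linear function and $\mathbf{b}\in\mathbb{R}^m$ such that $$\left\{\begin{bmatrix}1&\mathbf{x}^{\mathsf T}\\ \mathbf{x}&\mathsf{X}\end{bmatrix}\in\mathcal{S}^{n+1}_+:\mathcal{A}(\mathsf{X},\mathbf{x})=\mathbf{b}\right\}\supseteq\mathcal{G}(\mathcal{X}),\qquad \{\mathsf{X}\in\mathcal{S}^n_+:\mathcal{A}(\mathsf{X},\mathbf{0})=\mathbf{0}\}=\{\mathsf{O}\}.$$ Define, for $\mathbf{x}\in\mathbb{R}^n$, $$g(\mathbf{x})=\sup_{\Psi,\mathbf{u},\mathsf{U},\mathsf{X}}\left\{\begin{array}{l}\mathsf{A}\bullet\mathsf{X}+2\mathbf{a}^{\mathsf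 T}\mathbf{x}+2\mathsf{B}^{\mathsf T}\bullet\Psi+\mathsf{C}\bullet\mathsf{U}+2\mathbf{c}^{\mathsf T}\mathbf{u}\ :\\[2pt] \begin{bmatrix}1&\mathbf{u}^{\mathsf T}&\mathbf{x}^{\mathsf T}\\ \mathbf{u}&\mathsf{U}&\Psi^{\mathsf T}\\ \mathbf{x}&\Psi&\mathsf{X}\end{bmatrix}\in\mathcal{G}(\mathcal{U}\times\mathcal{X}),\ \begin{bmatrix}1&\mathbf{u}^{\mathsf T}\\ \mathbf{u}&\mathsf{U}\end{bmatrix}\in\mathcal{G}(\mathcal{U}),\ \mathcal{A}(\mathsf{X},\mathbf{x})=\mathbf{b}\end{array}\right\},$$ where $\Psi\in\mathbb{R}^{n\times q}$, $\mathbf{u}\in\mathbb{R}^q$, $\mathsf{U}\in\mathcal{S}^q$, $\mathsf{X}\in\mathcal{S}^n$. Then $g$ is the concave envelope of $f$ over $\mathcal{X}$.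
   Context: $\mathcal{S}^d$ is the space of symmetric $d\times d$ matrices, $\mathcal{S}^d_+$ the cone of positive semidefinite ones, $\mathsf{O}$ the zero matrix, $\mathsf{M}\bullet\mathsf{N}=\operatorname{Tr}(\mathsf{M}^{\mathsf T}\mathsf{N})$. For $\mathcal{F}\subseteq\mathbb{R}^d$, $\mathcal{G}(\mathcal{F})\subseteq\mathcal{S}^{d+1}$ is the closure of the convex hull of $\left\{\begin{bmatrix}1\\ \mathbf{y}\end{bmatrix}\begin{bmatrix}1\\ \mathbf{y}\end{bmatrix}^{\mathsf T}:\mathbf{y}\in\mathcal{F}\right\}$; elements of $\mathcal{U}\times\mathcal{X}$ are vectors $(\mathbf{u}^{\mathsf T},\mathbf{x}^{\mathsf T})^{\mathsf T}\in\mathbb{R}^{q+n}$. Convention: $\sup\emptyset=-\infty$. The concave envelope of $f$ over $\mathcal{X}$ is the smallest concave function $\mathbb{R}^n\to\mathbb{R}\cup\{\pm\infty\}$ that is greater than or equal to $f$ at every point of $\mathcal{X}$ (in particular it equals $-\infty$ outside $\operatorname{conv}(\mathcal{X})$). *)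

theory Defs
  imports "HOL-Analysis.Analysis"
begin

definition symmetric_mat :: "real^'d^'d \<Rightarrow> bool" where
  "symmetric_mat M \<longleftrightarrow> transpose M = M"

definition psd :: "real^'d^'d \<Rightarrow> bool" where
  "psd M \<longleftrightarrow> symmetric_mat M \<and> (\<forall>v. 0 \<le> v \<bullet> (M *v v))"

definition mat_dot :: "real^'k^'d \<Rightarrow> real^'k^'d \<Rightarrow> real"  (infixl "\<bullet>\<^sub>M" 70) where
  "M \<bullet>\<^sub>M N = trace (transpose M ** N)"

text \<open>A space of dimension \<open>d + 1\<close> is indexed by \<open>'d option\<close>, the leading coordinate being
  \<open>None\<close>; a space of dimension \<open>q + n\<close> is indexed by the sum type \<open>'q + 'n\<close>.\<close>

definition homogenize :: "real^'d \<Rightarrow> real^('d option)" where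
  "homogenize y = (\<chi> i. case i of None \<Rightarrow> 1 | Some j \<Rightarrow> y $ j)"

definition outer :: "real^'d \<Rightarrow> real^'d^'d" where
  "outer v = (\<chi> i j. v $ i * v $ j)"

text \<open>\<open>bordered y Y\<close> has the rows \<open>(1, y\<^sup>T)\<close> and \<open>(y, Y)\<close>.\<close>

definition bordered :: "real^'d \<Rightarrow> real^'d^'d \<Rightarrow> real^('d option)^('d option)" where
  "bordered y Y = (\<chi> i j. case i of
       None \<Rightarrow> (case j of None \<Rightarrow> 1 | Some l \<Rightarrow> y $ l)
     | Some k \<Rightarrow> (case j of None \<Rightarrow> y $ k | Some l \<Rightarrow> Y $ k $ l))"

definition stack :: "real^'q \<Rightarrow> real^'n \<Rightarrow> real^('q + 'n)" where
  "stack u x = (\<chi> i. case i of Inl k \<Rightarrow> u $ k | Inr k \<Rightarrow> x $ k)"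

definition stacked_product :: "(real^'q) set \<Rightarrow> (real^'n) set \<Rightarrow> (real^('q + 'n)) set" where
  "stacked_product S T = {stack u x | u x. u \<in> S \<and> x \<in> T}"

text \<open>\<open>blocks P Q R S\<close> has the block rows \<open>(P, Q)\<close> and \<open>(R, S)\<close>.\<close>

definition blocks :: "real^'q^'q \<Rightarrow> real^'n^'q \<Rightarrow> real^'q^'n \<Rightarrow> real^'n^'n
    \<Rightarrow> real^('q + 'n)^('q + 'n)" where
  "blocks P Q R S = (\<chi> i j. case i of
       Inl k \<Rightarrow> (case j of Inl l \<Rightarrow> P $ k $ l | Inr l \<Rightarrow> Q $ k $ l)
     | Inr k \<Rightarrow> (case j of Inl l \<Rightarrow> R $ k $ l | Inr l \<Rightarrow> S $ k $ l))"

definition lifted_hull :: "(real^'d) set \<Rightarrow> (real^('d option)^('d option)) set"  ("\<G>") where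
  "\<G> F = closure (convex hull ((\<lambda>y. outer (homogenize y)) ` F))"

text \<open>Linearity of a map on a linear subspace; values outside \<open>S\<close> are irrelevant.\<close>

definition linear_on_subspace ::
    "'a::real_vector set \<Rightarrow> ('a \<Rightarrow> 'b::real_vector) \<Rightarrow> bool" where
  "linear_on_subspace S L \<longleftrightarrow>
     (\<forall>v\<in>S. \<forall>w\<in>S. L (v + w) = L v + L w) \<and> (\<forall>c. \<forall>v\<in>S. L (c *\<^sub>R v) = c *\<^sub>R L v)"

text \<open>Concavity of an extended-real-valued function on the whole space is convexity of its
  hypograph, which avoids sums of the form \<open>\<infinity> - \<infinity>\<close>.\<close>

definition concave_ereal :: "('a::real_vector \<Rightarrow> ereal) \<Rightarrow> bool" where
  "concave_ereal h \<longleftrightarrow> convex {(x, t::real). ereal t \<le> h x}"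

definition is_concave_envelope ::
    "('a::real_vector \<Rightarrow> real) \<Rightarrow> 'a set \<Rightarrow> ('a \<Rightarrow> ereal) \<Rightarrow> bool" where
  "is_concave_envelope f S g \<longleftrightarrow>
     concave_ereal g \<and> (\<forall>x\<in>S. ereal (f x) \<le> g x) \<and>
     (\<forall>h. concave_ereal h \<and> (\<forall>x\<in>S. ereal (f x) \<le> h x) \<longrightarrow> (\<forall>x. g x \<le> h x))"

end

theory Submission
  imports Defs
begin

text \<open>The condition that \<open>0\<close> is the only positive semidefinite solution of
  \<open>\<A> (X, 0) = 0\<close> forces \<open>\<X>\<close> to be bounded: an unbounded sequence in \<open>\<X>\<close> would produce a
  unit vector \<open>v\<close> with \<open>\<A> (v v\<^sup>T, 0) = 0\<close>. So \<open>\<X>\<close> and \<open>\<U> \<times> \<X>\<close> are compact, and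
  \<open>\<G> (\<U> \<times> \<X>)\<close> is the convex hull of the rank-one lifts itself, with no limit points added.
  This is \<open>bounded_of_trivial_recession\<close>.

  Let \<open>F u x\<close> be the function maximized over \<open>u\<close> in \<open>f x\<close>, including its part that depends
  on \<open>x\<close> only. The objective of the problem defining \<open>g\<close> is linear in the matrix and takes the
  value \<open>F u x\<close> at the lift of \<open>(u, x)\<close>. The principal submatrices belonging to \<open>u\<close> and to \<open>x\<close>
  of a matrix in \<open>\<G> (\<U> \<times> \<X>)\<close> lie in \<open>\<G> \<U>\<close> and \<open>\<G> \<X>\<close>, so the other constraints hold
  automatically (\<open>hull_lift_stacked_product_blocks\<close>). Hence \<open>g x\<close> is the supremum of all \<open>t\<close>
  with \<open>(x, t)\<close> in the convex hull of the compact set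
  \<open>E = {(x, F u x) | u \<in> \<U>, x \<in> \<X>}\<close>.

  On the fibre of \<open>E\<close> over a point \<open>x\<close> of \<open>\<X>\<close> the largest value is \<open>f x\<close>. The upper boundary of
  the convex hull of such a set is the concave envelope
  (\<open>is_concave_envelope_Sup_convex_hull\<close>).\<close>

section \<open>The concave envelope as the upper boundary of a convex hull\<close>

text \<open>By compactness the supremum over each nonempty fibre of the hull is attained, so the
  hypograph of the right-hand side consists of the points that lie below the hull, and it
  inherits convexity from the hull. Minimality holds because the convex hypograph of any
  competitor contains \<open>E\<close> and hence its hull.\<close>

lemma is_concave_envelope_Sup_convex_hull:
  fixes E :: "('a::euclidean_space \<times> real) set"
  assumes "compact E"
    and below: "\<And>x t. (x, t) \<in> E \<Longrightarrow> x \<in> S \<and> t \<le> f x"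
    and graph: "\<And>x. x \<in> S \<Longrightarrow> (x, f x) \<in> E"
  shows "is_concave_envelope f S (\<lambda>x. Sup {ereal t | t. (x, t) \<in> convex hull E})"
    (is "is_concave_envelope f S ?g")
proof -
  let ?K = "convex hull E"
  have "compact ?K" using assms(1) by (rule compact_convex_hull)
  have upper: "ereal s \<le> ?g x" if "(x, s) \<in> ?K" for x s
    using that by (intro Sup_upper) blast
  have attained: "\<exists>s\<ge>t. (x, s) \<in> ?K" if "ereal t \<le> ?g x" for x t
  proof -
    let ?T = "snd ` (?K \<inter> {x} \<times> UNIV)"
    have "compact (?K \<inter> {x} \<times> UNIV)"
      using \<open>compact ?K\<close> by (intro compact_Int_closed closed_Times) auto
    then have "compact ?T"
      by (intro compact_continuous_image continuous_on_snd continuous_on_id)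
    moreover have "?T \<noteq> {}"
    proof
      assume "?T = {}"
      then have "{ereal t | t. (x, t) \<in> ?K} = {}" by force
      then have "?g x = - \<infinity>" by (simp add: bot_ereal_def)
      then show False using that by simp
    qed
    ultimately have "\<exists>s\<in>?T. \<forall>r\<in>?T. r \<le> s"
      by (rule compact_attains_sup)
    then obtain s where s: "(x, s) \<in> ?K" and max: "\<And>r. (x, r) \<in> ?K \<Longrightarrow> r \<le> s"
      by force
    have "?g x \<le> ereal s"
      by (rule Sup_least) (use max in force)
    then have "t \<le> s" using that by (meson ereal_less_eq(3) order_trans)
    then show ?thesis using s by auto
  qed
  have "convex {(x, t). ereal t \<le> ?g x}"
  proof (rule convexI)
    fix p q :: "'a \<times> real" and u v :: real
    assume p: "p \<in> {(x, t). ereal t \<le> ?g x}" and q: "q \<in> {(x, t). ereal t \<le> ?g x}"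
      and uv: "0 \<le> u" "0 \<le> v" "u + v = 1"
    obtain x t y s where pq: "p = (x, t)" "q = (y, s)" by fastforce
    have t: "ereal t \<le> ?g x" and s: "ereal s \<le> ?g y" using p q pq by simp_all
    obtain t' s' where t': "t' \<ge> t" "(x, t') \<in> ?K" and s': "s' \<ge> s" "(y, s') \<in> ?K"
      using attained[OF t] attained[OF s] by blast
    have "u *\<^sub>R (x, t') + v *\<^sub>R (y, s') \<in> ?K"
      using convexD[OF convex_convex_hull t'(2) s'(2) uv] .
    then have "ereal (u * t' + v * s') \<le> ?g (u *\<^sub>R x + v *\<^sub>R y)"
      by (intro upper) simp
    moreover have "u * t + v * s \<le> u * t' + v * s'"
      using t' s' uv by (intro add_mono mult_left_mono) auto
    ultimately have "ereal (u * t + v * s) \<le> ?g (u *\<^sub>R x + v *\<^sub>R y)"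
      by (meson ereal_less_eq(3) order_trans)
    then show "u *\<^sub>R p + v *\<^sub>R q \<in> {(x, t). ereal t \<le> ?g x}"
      by (simp add: pq)
  qed
  moreover have "\<forall>x\<in>S. ereal (f x) \<le> ?g x"
    by (intro ballI upper hull_inc graph)
  moreover have "?g x \<le> h x" if "concave_ereal h" "\<forall>x\<in>S. ereal (f x) \<le> h x" for h x
  proof -
    have "E \<subseteq> {(x, t). ereal t \<le> h x}"
      using below that(2) by clarsimp (meson ereal_less_eq(3) order_trans)
    then have "?K \<subseteq> {(x, t). ereal t \<le> h x}"
      using that(1) by (intro hull_minimal) (auto simp: concave_ereal_def)
    then show ?thesis by (intro Sup_least) auto
  qed
  ultimately show ?thesis
    unfolding is_concave_envelope_def concave_ereal_def[of ?g] by blast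
qed

section \<open>Linear maps on matrices and the rank-one lift\<close>

definition submatrix :: "('k \<Rightarrow> 'i) \<Rightarrow> ('l \<Rightarrow> 'j) \<Rightarrow> real^'j^'i \<Rightarrow> real^'l^'k" where
  "submatrix r s M = (\<chi> i j. M $ r i $ s j)"

lemma linear_submatrix: "linear (submatrix r s)"
  by (rule linearI) (simp_all add: submatrix_def vec_eq_iff)

text \<open>The analogue of \<open>submatrix\<close> for the leading row, which carries the vector part of a
  bordered matrix.\<close>

definition border :: "('k \<Rightarrow> 'd::finite option) \<Rightarrow> real^'d option^'d option \<Rightarrow> real^'k" where
  "border s M = (\<chi> j. M $ None $ s j)"

lemma linear_border: "linear (border s)"
  by (rule linearI) (simp_all add: border_def vec_eq_iff)

lemma mat_dot_eq_sum: "M \<bullet>\<^sub>M N = (\<Sum>i\<in>UNIV. \<Sum>j\<in>UNIV. M $ i $ j * N $ i $ j)"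
  unfolding mat_dot_def trace_def matrix_matrix_mult_def transpose_def
  by simp (rule sum.swap)

lemma linear_mat_dot: "linear ((\<bullet>\<^sub>M) M)"
  by (rule linearI) (simp_all add: mat_dot_eq_sum algebra_simps sum.distrib sum_distrib_left)

lemma mat_dot_rank_one: "M \<bullet>\<^sub>M (\<chi> i j. v $ i * w $ j) = v \<bullet> (M *v w)"
  by (simp add: mat_dot_eq_sum inner_vec_def matrix_vector_mult_def sum_distrib_left algebra_simps)

lemma transpose_outer [simp]: "transpose (outer v) = outer v"
  by (simp add: outer_def transpose_def vec_eq_iff mult.commute)

lemma psd_outer: "psd (outer v)"
proof -
  have "outer v *v w = (v \<bullet> w) *\<^sub>R v" for w
    by (simp add: outer_def inner_vec_def matrix_vector_mult_def vec_eq_iff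
        sum_distrib_left sum_distrib_right ac_simps)
  then show ?thesis by (simp add: psd_def symmetric_mat_def inner_commute)
qed

lemma continuous_on_vec_entries:
  assumes "\<And>i. continuous_on S (\<lambda>x. f x $ i)"
  shows "continuous_on S f"
  using continuous_on_vec_lambda[of S "\<lambda>i x. f x $ i"] assms by simp

lemma continuous_on_homogenize: "continuous_on S homogenize"
proof (rule continuous_on_vec_entries)
  show "continuous_on S (\<lambda>y. homogenize y $ i)" for i
    by (cases i) (auto simp: homogenize_def intro!: continuous_intros)
qed

lemma continuous_on_outer: "continuous_on S outer"
  by (intro continuous_on_vec_entries) (auto simp: outer_def intro!: continuous_intros)

lemma outer_homogenize_eq_bordered: "outer (homogenize y) = bordered y (outer y)"
  by (auto simp: outer_def homogenize_def bordered_def vec_eq_iff split: option.split)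

lemma bordered_eq_iff [simp]: "bordered y Y = bordered z Z \<longleftrightarrow> y = z \<and> Y = Z"
proof
  assume eq: "bordered y Y = bordered z Z"
  have "y $ k = z $ k" "Y $ k $ l = Z $ k $ l" for k l
    using arg_cong[OF eq, of "\<lambda>M. M $ Some k $ None"] arg_cong[OF eq, of "\<lambda>M. M $ Some k $ Some l"]
    by (simp_all add: bordered_def)
  then show "y = z \<and> Y = Z" by (simp add: vec_eq_iff)
qed simp

section \<open>Lifted convex hulls\<close>

lemma compact_lift_image:
  assumes "compact F"
  shows "compact ((\<lambda>y. outer (homogenize y)) ` F)"
  using assms
  by (intro compact_continuous_image continuous_on_compose2[OF continuous_on_outer]
      continuous_on_homogenize) auto

lemma lifted_hull_compact:
  assumes "compact F"
  shows "\<G> F = convex hull ((\<lambda>y. outer (homogenize y)) ` F)"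
  unfolding lifted_hull_def
  using compact_lift_image[OF assms] by (simp add: compact_convex_hull compact_imp_closed)

lemma compact_stacked_product:
  assumes "compact S" "compact T"
  shows "compact (stacked_product S T)"
proof -
  have "stacked_product S T = (\<lambda>(u, x). stack u x) ` (S \<times> T)"
    by (auto simp: stacked_product_def)
  moreover have "continuous_on (S \<times> T) (\<lambda>(u, x). stack u x)"
  proof (rule continuous_on_vec_entries)
    show "continuous_on (S \<times> T) (\<lambda>p. (case p of (u, x) \<Rightarrow> stack u x) $ i)" for i
      by (cases i) (auto simp: stack_def case_prod_unfold intro!: continuous_intros)
  qed
  ultimately show ?thesis
    using assms by (simp add: compact_Times compact_continuous_image)
qed

lemma hull_lift_symmetric_corner:
  assumes "M \<in> convex hull ((\<lambda>y. outer (homogenize y)) ` F)"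
  shows "transpose M = M" "M $ None $ None = 1"
proof -
  let ?S = "{M :: real^('a option)^('a option). transpose M = M \<and> M $ None $ None = 1}"
  have "convex ?S"
    by (rule convexI) (auto simp: transpose_def vec_eq_iff)
  moreover have "(\<lambda>y. outer (homogenize y)) ` F \<subseteq> ?S"
    by auto (simp add: outer_def homogenize_def)
  ultimately have "convex hull ((\<lambda>y. outer (homogenize y)) ` F) \<subseteq> ?S"
    by (intro hull_minimal) auto
  then show "transpose M = M" "M $ None $ None = 1" using assms by auto
qed

text \<open>A principal submatrix of a rank-one lift is the outer square of a subvector of the
  homogenized vector. If every such subvector is a homogenized point of \<open>G\<close>, linearity carries
  the membership over to hulls.\<close>

lemma submatrix_lifted_hull:
  assumes "M \<in> convex hull ((\<lambda>y. outer (homogenize y)) ` F)"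
    and "\<And>y. y \<in> F \<Longrightarrow> (\<chi> i. homogenize y $ r i) \<in> homogenize ` G"
  shows "submatrix r r M \<in> \<G> G"
proof -
  have "submatrix r r (outer (homogenize y)) \<in> (\<lambda>y. outer (homogenize y)) ` G" if "y \<in> F" for y
  proof -
    have "submatrix r r (outer (homogenize y)) = outer (\<chi> i. homogenize y $ r i)"
      by (simp add: submatrix_def outer_def)
    then show ?thesis using assms(2)[OF that] by auto
  qed
  then have "convex hull (submatrix r r ` (\<lambda>y. outer (homogenize y)) ` F)
      \<subseteq> convex hull ((\<lambda>y. outer (homogenize y)) ` G)"
    by (intro hull_mono) auto
  moreover have "submatrix r r M \<in> convex hull (submatrix r r ` (\<lambda>y. outer (homogenize y)) ` F)"
    using assms(1) convex_hull_linear_image[OF linear_submatrix] by blast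
  ultimately show ?thesis
    unfolding lifted_hull_def using closure_subset by blast
qed

text \<open>This lemma makes the separate constraints on \<open>(u, U)\<close> and on \<open>(x, X)\<close> redundant: both
  bordered blocks are principal submatrices, obtained by selecting the leading index together
  with one summand of the index type.\<close>

lemma hull_lift_stacked_product_blocks:
  assumes M: "M \<in> convex hull ((\<lambda>y. outer (homogenize y)) ` stacked_product S T)"
  obtains u x U \<Psi> X where "M = bordered (stack u x) (blocks U (transpose \<Psi>) \<Psi> X)"
    "symmetric_mat U" "symmetric_mat X" "bordered u U \<in> \<G> S" "bordered x X \<in> \<G> T"
proof -
  define u where "u = border (Some \<circ> Inl) M"
  define x where "x = border (Some \<circ> Inr) M"
  define U where "U = submatrix (Some \<circ> Inl) (Some \<circ> Inl) M"
  define \<Psi> where "\<Psi> = submatrix (Some \<circ> Inr) (Some \<circ> Inl) M"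
  define X where "X = submatrix (Some \<circ> Inr) (Some \<circ> Inr) M"
  note parts = u_def x_def U_def \<Psi>_def X_def submatrix_def border_def
  have corner: "M $ None $ None = 1" and "transpose M = M"
    using hull_lift_symmetric_corner[OF M] by auto
  have sym: "M $ i $ j = M $ j $ i" for i j
    by (subst \<open>transpose M = M\<close>[symmetric]) (simp add: transpose_def)
  have "M $ i $ j = bordered (stack u x) (blocks U (transpose \<Psi>) \<Psi> X) $ i $ j" for i j
    using corner sym[of i None] sym[of i j]
    by (auto simp: parts bordered_def stack_def blocks_def transpose_def
        split: option.split sum.split)
  then have M_eq: "M = bordered (stack u x) (blocks U (transpose \<Psi>) \<Psi> X)"
    by (simp add: vec_eq_iff)
  have "submatrix (map_option Inl) (map_option Inl) M \<in> \<G> S"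
    using M
  proof (rule submatrix_lifted_hull)
    fix y assume "y \<in> stacked_product S T"
    then obtain v z where "v \<in> S" "y = stack v z" by (auto simp: stacked_product_def)
    moreover have "(\<chi> i. homogenize (stack v z) $ map_option Inl i) = homogenize v"
      by (simp add: homogenize_def stack_def vec_eq_iff split: option.split)
    ultimately show "(\<chi> i. homogenize y $ map_option Inl i) \<in> homogenize ` S" by simp
  qed
  moreover have "submatrix (map_option Inl) (map_option Inl) M = bordered u U"
    unfolding M_eq
    by (simp add: submatrix_def bordered_def stack_def blocks_def vec_eq_iff split: option.split)
  moreover have "submatrix (map_option Inr) (map_option Inr) M \<in> \<G> T"
    using M
  proof (rule submatrix_lifted_hull)
    fix y assume "y \<in> stacked_product S T"
    then obtain v z where "z \<in> T" "y = stack v z" by (auto simp: stacked_product_def)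
    moreover have "(\<chi> i. homogenize (stack v z) $ map_option Inr i) = homogenize z"
      by (simp add: homogenize_def stack_def vec_eq_iff split: option.split)
    ultimately show "(\<chi> i. homogenize y $ map_option Inr i) \<in> homogenize ` T" by simp
  qed
  moreover have "submatrix (map_option Inr) (map_option Inr) M = bordered x X"
    unfolding M_eq
    by (simp add: submatrix_def bordered_def stack_def blocks_def vec_eq_iff split: option.split)
  moreover have "symmetric_mat U" "symmetric_mat X"
    unfolding symmetric_mat_def vec_eq_iff
    by (auto simp: U_def X_def submatrix_def transpose_def intro: sym)
  ultimately show ?thesis using that M_eq by metis
qed

section \<open>Boundedness from a trivial recession cone\<close>

text \<open>On the unit sphere \<open>\<A> (v v\<^sup>T, 0)\<close> does not vanish, so its norm has a minimum \<open>m > 0\<close>.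
  By homogeneity, \<open>m |x|\<^sup>2\<close> is at most the norm of \<open>\<A> (x x\<^sup>T, 0) = b - \<A> (0, x)\<close>, which grows
  at most linearly in \<open>|x|\<close>.\<close>

lemma bounded_of_trivial_recession:
  fixes \<X> :: "(real^'n) set" and \<A> :: "(real^'n^'n) \<times> (real^'n) \<Rightarrow> real^'m"
  assumes lin: "linear_on_subspace {(X, x). symmetric_mat X} \<A>"
    and eq: "\<And>x. x \<in> \<X> \<Longrightarrow> \<A> (outer x, x) = b"
    and rec: "\<And>X. psd X \<Longrightarrow> \<A> (X, 0) = 0 \<Longrightarrow> X = 0"
  shows "bounded \<X>"
proof -
  \<comment> \<open>\<open>\<A>\<close> is linear on symmetric matrices only; composing it with
    symmetrization gives a map that is linear, hence continuous, everywhere.\<close>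
  define L where "L = (\<lambda>(X, x). \<A> ((1/2) *\<^sub>R (X + transpose X), x))"
  have sym: "symmetric_mat ((1/2) *\<^sub>R (X + transpose X))" for X :: "real^'n^'n"
    by (simp add: symmetric_mat_def transpose_def vec_eq_iff)
  have add: "\<A> (X + Y, x + y) = \<A> (X, x) + \<A> (Y, y)"
    and scale: "\<A> (r *\<^sub>R X, r *\<^sub>R x) = r *\<^sub>R \<A> (X, x)"
    if "symmetric_mat X" "symmetric_mat Y" for X Y x y r
    using lin that unfolding linear_on_subspace_def by fastforce+
  have "linear L"
  proof (rule linearI)
    fix p q :: "(real^'n^'n) \<times> (real^'n)" and r :: real
    obtain X x Y y where pq: "p = (X, x)" "q = (Y, y)" by fastforce
    have "(1/2) *\<^sub>R ((X + Y) + transpose (X + Y))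
        = (1/2) *\<^sub>R (X + transpose X) + (1/2) *\<^sub>R (Y + transpose Y)"
      by (simp add: transpose_def vec_eq_iff algebra_simps)
    then show "L (p + q) = L p + L q"
      using add[OF sym[of X] sym[of Y]] by (simp add: L_def pq)
    have "(1/2) *\<^sub>R (r *\<^sub>R X + transpose (r *\<^sub>R X)) = r *\<^sub>R ((1/2) *\<^sub>R (X + transpose X))"
      by (simp add: transpose_def vec_eq_iff algebra_simps)
    then show "L (r *\<^sub>R p) = r *\<^sub>R L p"
      using scale[OF sym[of X] sym[of X]] by (simp add: L_def pq)
  qed
  then obtain K where K: "\<And>p. norm (L p) \<le> norm p * K"
    using bounded_linear.bounded linear_conv_bounded_linear by blast
  have L_outer: "L (outer x, y) = \<A> (outer x, y)" for x y :: "real^'n"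
  proof -
    have "(1/2) *\<^sub>R (outer x + transpose (outer x)) = outer x"
      by (simp add: vec_eq_iff)
    then show ?thesis by (simp add: L_def)
  qed
  let ?S = "sphere 0 1 :: (real^'n) set"
  have "continuous_on ?S (\<lambda>v. norm (L (outer v, 0)))"
    using \<open>linear L\<close>[unfolded linear_conv_bounded_linear]
    by (intro continuous_on_norm bounded_linear.continuous_on[of L] continuous_on_Pair
        continuous_on_outer continuous_on_const)
  moreover have "?S \<noteq> {}" by simp
  ultimately obtain v where v: "v \<in> ?S"
    and min: "\<And>w. w \<in> ?S \<Longrightarrow> norm (L (outer v, 0)) \<le> norm (L (outer w, 0))"
    using continuous_attains_inf[of ?S] compact_sphere by blast
  define m where "m = norm (L (outer v, 0))"
  have "m > 0"
  proof (rule ccontr)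
    assume "\<not> m > 0"
    then have "outer v = 0" using rec[OF psd_outer, of v] L_outer by (simp add: m_def)
    then have "v = 0" by (simp add: outer_def vec_eq_iff)
    then show False using v by simp
  qed
  have quad: "m * (norm x)\<^sup>2 \<le> norm (L (outer x, 0))" for x
  proof (cases "x = 0")
    case False
    have "(outer x, 0) = (norm x)\<^sup>2 *\<^sub>R (outer (x /\<^sub>R norm x), 0 :: real^'n)"
      using False by (simp add: outer_def vec_eq_iff field_simps power2_eq_square)
    then have "L (outer x, 0) = (norm x)\<^sup>2 *\<^sub>R L (outer (x /\<^sub>R norm x), 0)"
      using linear_scale[OF \<open>linear L\<close>] by metis
    moreover have "m \<le> norm (L (outer (x /\<^sub>R norm x), 0))"
      unfolding m_def using False by (intro min) simp
    ultimately show ?thesis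
      by (simp add: mult.commute[of m] mult_left_mono)
  qed simp
  have "norm x \<le> max 1 ((norm b + \<bar>K\<bar>) / m)" if "x \<in> \<X>" for x
  proof (cases "norm x \<le> 1")
    case False
    then have "norm x \<ge> 1" by simp
    have "L (outer x, 0) + L (0, x) = b"
      using linear_add[OF \<open>linear L\<close>, of "(outer x, 0)" "(0, x)"] eq[OF that] L_outer by simp
    then have "norm (L (outer x, 0)) \<le> norm b + norm (L (0, x))"
      by (metis add_diff_cancel_right' norm_triangle_ineq4)
    also have "norm (L (0, x)) \<le> norm x * K"
      using K[of "(0, x)"] by simp
    also have "\<dots> \<le> norm x * \<bar>K\<bar>"
      by (intro mult_left_mono) auto
    also have "norm b \<le> norm x * norm b"
      using mult_right_mono[OF \<open>norm x \<ge> 1\<close>, of "norm b"] by simp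
    finally have "m * (norm x)\<^sup>2 \<le> norm x * (norm b + \<bar>K\<bar>)"
      using quad[of x] by (simp add: algebra_simps)
    then have "norm x * (m * norm x) \<le> norm x * (norm b + \<bar>K\<bar>)"
      by (simp add: power2_eq_square algebra_simps)
    then have "m * norm x \<le> norm b + \<bar>K\<bar>"
      using False by (subst (asm) mult_le_cancel_left_pos) auto
    then show ?thesis using \<open>m > 0\<close> by (simp add: field_simps le_max_iff_disj)
  qed simp
  then show ?thesis unfolding bounded_iff by blast
qed

section \<open>The concave envelope of the max-quadratic function\<close>

theorem theorem13:
  fixes \<U> :: "(real^'q) set" and \<X> :: "(real^'n) set"
    and A :: "real^'n^'n" and B :: "real^'n^'q" and C :: "real^'q^'q"
    and a :: "real^'n" and c :: "real^'q"
    and \<A> :: "(real^'n^'n) \<times> (real^'n) \<Rightarrow> real^'m" and b :: "real^'m"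
    and f :: "real^'n \<Rightarrow> real" and g :: "real^'n \<Rightarrow> ereal"
  assumes "\<U> \<noteq> {}" and "compact \<U>" and "convex \<U>"
    and "symmetric_mat A" and "symmetric_mat C"
    and f: "\<And>x. f x = x \<bullet> (A *v x) + 2 * (a \<bullet> x)
        + (GREATEST v. \<exists>u\<in>\<U>. v = 2 * (u \<bullet> (B *v x)) + u \<bullet> (C *v u) + 2 * (c \<bullet> u))"
    and "closed \<X>"
    and "linear_on_subspace {(X, x). symmetric_mat X} \<A>"
    and "{bordered x X | x X. symmetric_mat X \<and> psd (bordered x X) \<and> \<A> (X, x) = b} \<supseteq> \<G> \<X>"
    and "{X. psd X \<and> \<A> (X, 0) = 0} = {0}"
    and g: "\<And>x. g x = Sup {ereal (A \<bullet>\<^sub>M X + 2 * (a \<bullet> x) + 2 * (transpose B \<bullet>\<^sub>M \<Psi>)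
                              + C \<bullet>\<^sub>M U + 2 * (c \<bullet> u)) | \<Psi> u U X.
          symmetric_mat U \<and> symmetric_mat X
          \<and> bordered (stack u x) (blocks U (transpose \<Psi>) \<Psi> X) \<in> \<G> (stacked_product \<U> \<X>)
          \<and> bordered u U \<in> \<G> \<U>
          \<and> \<A> (X, x) = b}"
  shows "is_concave_envelope f \<X> g"
proof -
  define lift where "lift = (\<lambda>y :: real^('q + 'n). outer (homogenize y))"
  define F where "F = (\<lambda>u x. x \<bullet> (A *v x) + 2 * (a \<bullet> x)
      + (2 * (u \<bullet> (B *v x)) + u \<bullet> (C *v u) + 2 * (c \<bullet> u)))"

  have "\<A> (outer x, x) = b" if "x \<in> \<X>" for x
  proof -
    have "outer (homogenize x) \<in> \<G> \<X>"
      unfolding lifted_hull_def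
      by (intro subsetD[OF closure_subset] hull_inc imageI that)
    then show ?thesis
      using assms(9) by (auto simp: outer_homogenize_eq_bordered)
  qed
  moreover have "X = 0" if "psd X" "\<A> (X, 0) = 0" for X
    using assms(10) that by blast
  ultimately have "compact \<X>"
    using bounded_of_trivial_recession[OF assms(8)] assms(7) compact_eq_bounded_closed by blast
  then have compact_prod: "compact (stacked_product \<U> \<X>)"
    using assms(2) compact_stacked_product by blast
  then have G_prod: "\<G> (stacked_product \<U> \<X>) = convex hull (lift ` stacked_product \<U> \<X>)"
    unfolding lift_def by (rule lifted_hull_compact)

  \<comment> \<open>The linear map that reads off \<open>x\<close> and the objective value from a matrix variable.\<close>
  define R :: "real^('q + 'n) option^('q + 'n) option \<Rightarrow> (real^'n) \<times> real"
    where "R = (\<lambda>M. (border (Some \<circ> Inr) M,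
      A \<bullet>\<^sub>M submatrix (Some \<circ> Inr) (Some \<circ> Inr) M
      + 2 * (a \<bullet> border (Some \<circ> Inr) M)
      + 2 * (transpose B \<bullet>\<^sub>M submatrix (Some \<circ> Inr) (Some \<circ> Inl) M)
      + C \<bullet>\<^sub>M submatrix (Some \<circ> Inl) (Some \<circ> Inl) M
      + 2 * (c \<bullet> border (Some \<circ> Inl) M)))"
  have "linear R"
    unfolding R_def
    by (rule linearI) (simp_all add: linear_add[OF linear_border]
        linear_scale[OF linear_border] linear_add[OF linear_submatrix] linear_scale[OF linear_submatrix]
        linear_add[OF linear_mat_dot] linear_scale[OF linear_mat_dot] algebra_simps)
  have R_bordered: "R (bordered (stack u x) (blocks U (transpose \<Psi>) \<Psi> X))
      = (x, A \<bullet>\<^sub>M X + 2 * (a \<bullet> x) + 2 * (transpose B \<bullet>\<^sub>M \<Psi>) + C \<bullet>\<^sub>M U + 2 * (c \<bullet> u))"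
    for u x U \<Psi> X
    by (simp add: R_def border_def submatrix_def bordered_def stack_def blocks_def vec_lambda_eta)
  have R_lift: "R (lift (stack u x)) = (x, F u x)" for u x
  proof -
    let ?\<Psi> = "(\<chi> i j. x $ i * u $ j) :: real^'q^'n"
    have "outer (stack u x) = blocks (outer u) (transpose ?\<Psi>) ?\<Psi> (outer x)"
      by (auto simp: outer_def stack_def blocks_def transpose_def vec_eq_iff split: sum.split)
    then have "R (lift (stack u x)) = (x, A \<bullet>\<^sub>M outer x + 2 * (a \<bullet> x)
        + 2 * (transpose B \<bullet>\<^sub>M ?\<Psi>) + C \<bullet>\<^sub>M outer u + 2 * (c \<bullet> u))"
      by (simp add: lift_def outer_homogenize_eq_bordered R_bordered)
    moreover have "x \<bullet> (transpose B *v u) = u \<bullet> (B *v x)"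
      by (metis dot_lmul_matrix inner_commute transpose_matrix_vector)
    ultimately show ?thesis
      by (simp add: F_def outer_def mat_dot_rank_one)
  qed

  define E where "E = R ` lift ` stacked_product \<U> \<X>"
  have E_iff: "(x, t) \<in> E \<longleftrightarrow> x \<in> \<X> \<and> (\<exists>u\<in>\<U>. t = F u x)" for x t
  proof -
    have "E = {(x, F u x) | u x. u \<in> \<U> \<and> x \<in> \<X>}"
      unfolding E_def stacked_product_def R_lift[symmetric] by blast
    then show ?thesis by auto
  qed
  have "compact E"
    unfolding E_def
  proof (rule compact_continuous_image)
    show "continuous_on (lift ` stacked_product \<U> \<X>) R"
      using \<open>linear R\<close> by (simp add: linear_continuous_on linear_conv_bounded_linear)
    show "compact (lift ` stacked_product \<U> \<X>)"
      unfolding lift_def using compact_prod by (rule compact_lift_image)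
  qed
  have hull_E: "convex hull E = R ` \<G> (stacked_product \<U> \<X>)"
    unfolding E_def G_prod by (rule convex_hull_linear_image[OF \<open>linear R\<close>, symmetric])

  have f_max: "\<exists>u\<in>\<U>. f x = F u x \<and> (\<forall>w\<in>\<U>. F w x \<le> f x)" for x
  proof -
    let ?\<phi> = "\<lambda>u. 2 * (u \<bullet> (B *v x)) + u \<bullet> (C *v u) + 2 * (c \<bullet> u)"
    have "continuous_on \<U> ?\<phi>"
      by (intro continuous_intros matrix_vector_mult_linear_continuous_on)
    then obtain u where u: "u \<in> \<U>" "\<And>w. w \<in> \<U> \<Longrightarrow> ?\<phi> w \<le> ?\<phi> u"
      using continuous_attains_sup[OF assms(2,1)] by blast
    then have "(GREATEST v. \<exists>u\<in>\<U>. v = ?\<phi> u) = ?\<phi> u"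
      by (intro Greatest_equality) auto
    then have "f x = F u x" by (simp add: f F_def)
    moreover have "F w x \<le> F u x" if "w \<in> \<U>" for w
      using u(2)[OF that] by (simp add: F_def)
    ultimately show ?thesis using u(1) by auto
  qed

  have g_eq: "g x = Sup {ereal t | t. (x, t) \<in> convex hull E}" for x
  proof (rule antisym)
    show "g x \<le> Sup {ereal t | t. (x, t) \<in> convex hull E}"
      unfolding g
    proof (rule Sup_subset_mono, clarify)
      fix \<Psi> u U X
      assume "bordered (stack u x) (blocks U (transpose \<Psi>) \<Psi> X) \<in> \<G> (stacked_product \<U> \<X>)"
      then show "\<exists>t. ereal (A \<bullet>\<^sub>M X + 2 * (a \<bullet> x) + 2 * (transpose B \<bullet>\<^sub>M \<Psi>)
          + C \<bullet>\<^sub>M U + 2 * (c \<bullet> u)) = ereal t \<and> (x, t) \<in> convex hull E"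
        unfolding hull_E by (metis R_bordered image_eqI)
    qed
    show "Sup {ereal t | t. (x, t) \<in> convex hull E} \<le> g x"
    proof (rule Sup_least, clarify)
      fix t assume "(x, t) \<in> convex hull E"
      then obtain M where M: "M \<in> \<G> (stacked_product \<U> \<X>)" "R M = (x, t)"
        unfolding hull_E by (metis imageE)
      obtain u x' U \<Psi> X where dec: "M = bordered (stack u x') (blocks U (transpose \<Psi>) \<Psi> X)"
          "symmetric_mat U" "symmetric_mat X" "bordered u U \<in> \<G> \<U>" "bordered x' X \<in> \<G> \<X>"
        using M(1)[unfolded G_prod lift_def] by (rule hull_lift_stacked_product_blocks)
      have x: "x' = x" and t: "t = A \<bullet>\<^sub>M X + 2 * (a \<bullet> x) + 2 * (transpose B \<bullet>\<^sub>M \<Psi>)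
          + C \<bullet>\<^sub>M U + 2 * (c \<bullet> u)"
        using M(2) unfolding dec(1) R_bordered by auto
      have "\<A> (X, x) = b" using dec(5) assms(9) by (auto simp: x)
      then show "ereal t \<le> g x"
        unfolding g t using dec(2-4) M(1)[unfolded dec(1) x]
        by (intro Sup_upper CollectI exI[of _ \<Psi>] exI[of _ u] exI[of _ U] exI[of _ X] conjI) auto
    qed
  qed
  have "is_concave_envelope f \<X> (\<lambda>x. Sup {ereal t | t. (x, t) \<in> convex hull E})"
    using \<open>compact E\<close>
  proof (rule is_concave_envelope_Sup_convex_hull)
    show "x \<in> \<X> \<and> t \<le> f x" if "(x, t) \<in> E" for x t
      using that f_max[of x] by (auto simp: E_iff)
    show "(x, f x) \<in> E" if "x \<in> \<X>" for x
      using that f_max[of x] by (auto simp: E_iff)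
  qed
  then show ?thesis unfolding g_eq[symmetric] .
qed

end
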